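(* Let $0<2\varepsilon<\delta\le 1/2$ be reals and let $r,s\ge\varepsilon^{-2}$ be integers. Then $$|\mathcal{A}_{\delta}(AU(\delta,r,s))|=\Theta\big(\sqrt{\delta}\,r^2s^2\big),\qquad |\mathcal{N}_{\varepsilon}(AU(\delta,r,s))|=\Theta\big((\varepsilon rs)^2/\delta\big),$$ where the implied constants in both $\Theta$'s are absolute (independent of $\varepsilon,\delta,r,s$).
   Context: For $0<\delta<1$ and integers $r,s\ge2$, the annulus construction is the set $$AU(\delta,r,s)=\left\{\left(\tfrac12-\tfrac{\delta l}{2s}\right)\left(\cos\tfrac{\pi k}{r},\ \sin\tfrac{\pi k}{r}\right): k\in\{-r,-r+1,\dots,r-1\},\ l\in\{0,1,\dots,s-1\}\right\}\subset\mathbb{R}^2.$$ For a finite set $X\subset\mathbb{R}^2$ and $0<\eta<1$, $\mathcal{A}_\eta(X)$ is the set of unordered pairs $\{x,y\}\subset X$ of distinct points with $\|x-y\|\ge 1-\eta$, and $\mathcal{N}_\eta(X)$ is the set of unordered pairs $\{x,y\}\subset X$ of distinct points with $\|x-y\|\le\eta$ (Euclidean norm). $f=\Theta(g)$ means $cg\le f\le Cg$ for some absolute constants $0<c\le C$. *)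

theory Defs
  imports "HOL-Analysis.Analysis"
begin

definition AU :: "real \<Rightarrow> int \<Rightarrow> int \<Rightarrow> (real^2) set" where
  "AU \<delta> r s =
     {(1 / 2 - \<delta> * of_int l / (2 * of_int s)) *\<^sub>R
        vector [cos (pi * of_int k / of_int r), sin (pi * of_int k / of_int r)] | k l.
      k \<in> {-r..r - 1} \<and> l \<in> {0..s - 1}}"

text \<open>Unordered pairs of distinct points are represented as two-element sets.\<close>

definition far_pairs :: "real \<Rightarrow> (real^2) set \<Rightarrow> (real^2) set set" where
  "far_pairs \<eta> X = {{x, y} | x y. x \<in> X \<and> y \<in> X \<and> x \<noteq> y \<and> norm (x - y) \<ge> 1 - \<eta>}"

definition near_pairs :: "real \<Rightarrow> (real^2) set \<Rightarrow> (real^2) set set" where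
  "near_pairs \<eta> X = {{x, y} | x y. x \<in> X \<and> y \<in> X \<and> x \<noteq> y \<and> norm (x - y) \<le> \<eta>}"

end

theory Submission
  imports Defs
begin

text \<open>
  The annulus construction is a polar grid with \<open>2r\<close> directions and \<open>s\<close> radii, all radii lying
  in \<open>[1/4, 1/2]\<close>.  Two grid points of radii \<open>a\<close>, \<open>b\<close> whose angles differ by
  \<open>2 \<pi> u\<close>, where \<open>u = (k - k') / (2r)\<close>, satisfy
  \<open>|x - y|\<^sup>2 = (a - b)\<^sup>2 + 4ab sin\<^sup>2(\<pi> u) = (a + b)\<^sup>2 - 4ab cos\<^sup>2(\<pi> u)\<close>
  (\<open>norm_grid_point_diff_sq\<close>).  Both estimates are read off from this formula, since
  \<open>4ab\<close> lies between \<open>1/4\<close> and \<open>1\<close> and the sine is comparable to the distance from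
  \<open>u\<close> to the integers (\<open>abs_sin_pi_ge\<close> in one direction, \<open>|sin x| \<le> |x|\<close> in the other).

  A pair can only be at distance at least \<open>1 - \<delta>\<close> if \<open>cos\<^sup>2(\<pi> u)\<close> is of order at most
  \<open>\<delta>\<close>, that is, if the directions are antipodal up to \<open>O(sqrt \<delta>)\<close>; conversely this is
  enough if both radii belong to the outermost part of the annulus.  Hence a positive fraction of
  all pairs of radii occurs, and for each first point about \<open>sqrt \<delta> r\<close> directions of the
  second point do: this gives the order \<open>(r s) (sqrt \<delta> r) s\<close>.

  A pair is at distance at most \<open>\<epsilon>\<close> essentially if and only if both the directions and the
  radii differ by \<open>O(\<epsilon>)\<close>.  The angular step is \<open>\<pi>/r\<close> and the radial step
  \<open>\<delta>/(2s)\<close>, so each point has about \<open>\<epsilon> r\<close> times \<open>\<epsilon> s/\<delta>\<close> near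
  neighbours: this gives the order \<open>(r s) (\<epsilon> r) (\<epsilon> s/\<delta>)\<close>.

  In terms of grid indices the upper bounds count all integers in certain intervals, and
  \<open>r, s \<ge> \<epsilon>\<^sup>-\<^sup>2\<close> makes the interval lengths bounded below, so that rounding costs only a
  constant factor (\<open>regime_bounds\<close>).  The lower bounds exhibit explicit families of pairs,
  always listed with the smaller direction index first so that no unordered pair is listed twice
  (\<open>card_le_unordered_pairs\<close>).
\<close>

section \<open>The sine and the distance to the nearest integer\<close>

text \<open>
  Jordan's inequality: by concavity the sine lies above its chord from \<open>0\<close> to \<open>\<pi>/2\<close>.
\<close>
lemma abs_sin_pi_ge:
  fixes u :: real
  assumes "\<bar>u\<bar> \<le> 1 / 2"
  shows "2 * \<bar>u\<bar> \<le> \<bar>sin (pi * u)\<bar>"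
proof -
  have *: "2 * v \<le> sin (pi * v)" if v: "0 \<le> v" "v \<le> 1 / 2" for v :: real
  proof -
    have conv: "convex_on {0..pi/2} (\<lambda>x. - sin x)"
    proof (rule f''_ge0_imp_convex)
      show "((\<lambda>x. - sin x) has_real_derivative (- cos x)) (at x)" for x :: real
        by (auto intro!: derivative_eq_intros)
      show "((\<lambda>x. - cos x) has_real_derivative (sin x)) (at x)" for x :: real
        by (auto intro!: derivative_eq_intros)
      show "0 \<le> sin x" if "x \<in> {0..pi/2}" for x :: real
        using that by (auto intro!: sin_ge_zero)
    qed auto
    have "- sin ((1 - 2 * v) *\<^sub>R 0 + (2 * v) *\<^sub>R (pi / 2))
        \<le> (1 - 2 * v) * (- sin 0) + 2 * v * (- sin (pi / 2))"
      by (rule convex_onD[OF conv]) (use v in auto)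
    then show ?thesis by (simp add: mult.commute)
  qed
  show ?thesis
  proof (cases "u \<ge> 0")
    case True
    then show ?thesis using *[of u] assms by simp
  next
    case False
    then show ?thesis using *[of "-u"] assms by simp
  qed
qed

text \<open>
  All three integers are needed: an index difference \<open>k - k'\<close> is only bounded by \<open>2r\<close>, so
  two neighbouring directions may lie on different sides of the cut at angle \<open>-\<pi>\<close>.
\<close>
lemma abs_sin_pi_le_imp_near_integer:
  fixes u c :: real
  assumes "\<bar>u\<bar> \<le> 1" and "\<bar>sin (pi * u)\<bar> \<le> 2 * c"
  shows "\<bar>u\<bar> \<le> c \<or> \<bar>u - 1\<bar> \<le> c \<or> \<bar>u + 1\<bar> \<le> c"
proof -
  consider "\<bar>u\<bar> \<le> 1/2" | "u \<ge> 1/2" | "u \<le> -1/2" by linarith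
  then show ?thesis
  proof cases
    case 1
    then show ?thesis using abs_sin_pi_ge[of u] assms by linarith
  next
    case 2
    have "sin (pi * (u - 1)) = - sin (pi * u)"
      by (simp add: right_diff_distrib sin_diff)
    then show ?thesis using abs_sin_pi_ge[of "u - 1"] 2 assms by simp
  next
    case 3
    have "sin (pi * (u + 1)) = - sin (pi * u)"
      by (simp add: distrib_left sin_add)
    then show ?thesis using abs_sin_pi_ge[of "u + 1"] 3 assms by simp
  qed
qed

lemma abs_cos_pi_le_imp_near_half:
  fixes u c :: real
  assumes "\<bar>u\<bar> \<le> 1" and "\<bar>cos (pi * u)\<bar> \<le> 2 * c"
  shows "\<bar>u - 1 / 2\<bar> \<le> c \<or> \<bar>u + 1 / 2\<bar> \<le> c"
proof (cases "u \<ge> 0")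
  case True
  have "sin (pi * (u - 1 / 2)) = - cos (pi * u)"
    by (simp add: right_diff_distrib sin_diff)
  moreover have "\<bar>u - 1 / 2\<bar> \<le> 1 / 2" using True assms by linarith
  ultimately have "2 * \<bar>u - 1 / 2\<bar> \<le> 2 * c" using abs_sin_pi_ge[of "u - 1 / 2"] assms by simp
  then show ?thesis by simp
next
  case False
  have "sin (pi * (u + 1 / 2)) = cos (pi * u)"
    by (simp add: distrib_left sin_add)
  moreover have "\<bar>u + 1 / 2\<bar> \<le> 1 / 2" using False assms by linarith
  ultimately have "2 * \<bar>u + 1 / 2\<bar> \<le> 2 * c" using abs_sin_pi_ge[of "u + 1 / 2"] assms by simp
  then show ?thesis by simp
qed

section \<open>Distances in the polar grid\<close>

definition radius :: "real \<Rightarrow> int \<Rightarrow> int \<Rightarrow> real" where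
  "radius \<delta> s l = 1 / 2 - \<delta> * of_int l / (2 * of_int s)"

definition grid_point :: "real \<Rightarrow> int \<Rightarrow> int \<Rightarrow> int \<times> int \<Rightarrow> real^2" where
  "grid_point \<delta> r s = (\<lambda>(k, l). radius \<delta> s l *\<^sub>R
     vector [cos (pi * of_int k / of_int r), sin (pi * of_int k / of_int r)])"

definition grid :: "int \<Rightarrow> int \<Rightarrow> (int \<times> int) set" where
  "grid r s = {-r..r - 1} \<times> {0..s - 1}"

lemma AU_eq_image_grid: "AU \<delta> r s = grid_point \<delta> r s ` grid r s"
  unfolding AU_def grid_def grid_point_def radius_def by (auto simp: image_iff Bex_def) blast+

lemma card_grid:
  assumes "r \<ge> 0" "s \<ge> 0"
  shows "real (card (grid r s)) = 2 * of_int r * of_int s"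
  using assms by (simp add: grid_def card_cartesian_product)

lemma norm_polar_diff_sq:
  fixes a b x y :: real
  shows "(norm (a *\<^sub>R (vector [cos x, sin x] :: real^2) - b *\<^sub>R vector [cos y, sin y]))\<^sup>2
    = (a - b)\<^sup>2 + 4 * a * b * (sin ((x - y) / 2))\<^sup>2"
proof -
  have "(norm (a *\<^sub>R (vector [cos x, sin x] :: real^2) - b *\<^sub>R vector [cos y, sin y]))\<^sup>2
      = (a * cos x - b * cos y)\<^sup>2 + (a * sin x - b * sin y)\<^sup>2"
    by (simp add: norm_vec_def L2_set_def sum_2)
  also have "\<dots> = a\<^sup>2 * ((sin x)\<^sup>2 + (cos x)\<^sup>2) + b\<^sup>2 * ((sin y)\<^sup>2 + (cos y)\<^sup>2)
      - 2 * a * b * (cos x * cos y + sin x * sin y)"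
    by (simp only: power2_eq_square) algebra
  also have "\<dots> = a\<^sup>2 + b\<^sup>2 - 2 * a * b * cos (x - y)"
    by (simp add: cos_diff)
  also have "cos (x - y) = 1 - 2 * (sin ((x - y) / 2))\<^sup>2"
    using cos_double_sin[of "(x - y) / 2"] by (simp only: mult_2 field_sum_of_halves)
  finally show ?thesis by (simp add: power2_eq_square algebra_simps)
qed

text \<open>
  The distance depends on the directions only through \<open>k - k'\<close>.  The argument of the sine is kept
  in the form \<open>\<pi> u\<close> so that the estimates in terms of the distance from \<open>u\<close> to the
  integers apply.
\<close>
lemma norm_grid_point_diff_sq:
  assumes "r > 0"
  shows "(norm (grid_point \<delta> r s (k, l) - grid_point \<delta> r s (k', l')))\<^sup>2
    = (radius \<delta> s l - radius \<delta> s l')\<^sup>2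
      + 4 * radius \<delta> s l * radius \<delta> s l' * (sin (pi * (of_int (k - k') / (2 * of_int r))))\<^sup>2"
proof -
  have "(pi * of_int k / of_int r - pi * of_int k' / of_int r) / 2
      = pi * (of_int (k - k') / (2 * of_int r))"
    using assms by (simp add: field_simps)
  then show ?thesis unfolding grid_point_def prod.case norm_polar_diff_sq by (simp only:)
qed

lemma radius_bounds:
  assumes "0 < \<delta>" "\<delta> \<le> 1 / 2" "l \<in> {0..s - 1}"
  shows "1 / 4 \<le> radius \<delta> s l" "radius \<delta> s l \<le> 1 / 2"
proof -
  from assms have s: "s > 0" and l: "0 \<le> (of_int l :: real)" "(of_int l :: real) \<le> of_int s" by auto
  have "\<delta> * of_int l \<le> (1 / 2) * of_int s"
    using assms l by (intro mult_mono) auto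
  then show "1 / 4 \<le> radius \<delta> s l" using s by (simp add: radius_def field_simps)
  show "radius \<delta> s l \<le> 1 / 2" using assms l s by (simp add: radius_def)
qed

lemma abs_radius_diff:
  assumes "\<delta> > 0" "s > 0"
  shows "\<bar>radius \<delta> s l - radius \<delta> s l'\<bar> = \<delta> * \<bar>of_int l' - of_int l\<bar> / (2 * of_int s)"
proof -
  have "radius \<delta> s l - radius \<delta> s l' = \<delta> * (of_int l' - of_int l) / (2 * of_int s)"
    using assms by (simp add: radius_def field_simps)
  then show ?thesis using assms by (simp add: abs_mult)
qed

text \<open>
  In the distance formula both summands vanish for coinciding points, and \<open>|u| < 1\<close> on the grid,
  so that \<open>sin (\<pi> u) = 0\<close> forces \<open>u = 0\<close>.  By injectivity, counting points is counting
  indices.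
\<close>
lemma inj_on_grid_point:
  assumes d: "0 < \<delta>" "\<delta> \<le> 1 / 2"
  shows "inj_on (grid_point \<delta> r s) (grid r s)"
proof (rule inj_onI, clarify)
  fix k l k' l'
  assume in1: "(k, l) \<in> grid r s" and in2: "(k', l') \<in> grid r s"
    and eq: "grid_point \<delta> r s (k, l) = grid_point \<delta> r s (k', l')"
  from in1 in2 have r: "r > 0" and s: "s > 0" and kk: "\<bar>k - k'\<bar> < 2 * r" by (auto simp: grid_def)
  let ?a = "radius \<delta> s l" and ?b = "radius \<delta> s l'"
  let ?u = "of_int (k - k') / (2 * of_int r) :: real"
  have ab: "?a \<ge> 1/4" "?b \<ge> 1/4" using radius_bounds[OF d] in1 in2 by (auto simp: grid_def)
  have z: "(?a - ?b)\<^sup>2 + 4 * ?a * ?b * (sin (pi * ?u))\<^sup>2 = 0"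
    using norm_grid_point_diff_sq[OF r, of \<delta> s k l k' l'] eq by simp
  have nn: "0 \<le> (?a - ?b)\<^sup>2" "0 \<le> 4 * ?a * ?b * (sin (pi * ?u))\<^sup>2" using ab by auto
  have 1: "(?a - ?b)\<^sup>2 = 0" and 2: "4 * ?a * ?b * (sin (pi * ?u))\<^sup>2 = 0"
    using z nn by linarith+
  from 1 abs_radius_diff[OF d(1) s, of l l'] d s have "l = l'" by simp
  from 2 ab have s0: "sin (pi * ?u) = 0" by auto
  have "\<bar>of_int (k - k') :: real\<bar> < 2 * of_int r" using kk by linarith
  then have u1: "\<bar>?u\<bar> < 1" using r by (simp add: abs_divide field_simps)
  from abs_sin_pi_le_imp_near_integer[of ?u 0] s0 u1 have "?u = 0" by linarith
  with r have "k = k'" by simp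
  with \<open>l = l'\<close> show "k = k' \<and> l = l'" by simp
qed

section \<open>Counting unordered pairs and integers in intervals\<close>

text \<open>
  Passing from unordered to ordered pairs of indices costs only a factor \<open>2\<close>, and hence is harmless
  for an upper bound.
\<close>
lemma card_unordered_pairs_le:
  fixes P :: "'a \<Rightarrow> 'b"
  assumes "finite T"
    and "\<And>a b. a \<in> I \<Longrightarrow> b \<in> I \<Longrightarrow> R (P a) (P b) \<Longrightarrow> (a, b) \<in> T"
  shows "card {{x, y} | x y. x \<in> P ` I \<and> y \<in> P ` I \<and> x \<noteq> y \<and> R x y} \<le> card T"
proof -
  have "{{x, y} | x y. x \<in> P ` I \<and> y \<in> P ` I \<and> x \<noteq> y \<and> R x y} \<subseteq> (\<lambda>(a, b). {P a, P b}) ` T"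
    using assms(2) by force
  then show ?thesis using assms(1) by (meson card_image_le card_mono finite_imageI le_trans)
qed

text \<open>
  Listing every pair with the smaller first coordinate in front rules out that the same unordered
  pair arises from two elements of \<open>T\<close>, so no factor is lost.
\<close>
lemma card_le_unordered_pairs:
  fixes P :: "'k::linorder \<times> 'l \<Rightarrow> 'b"
  assumes fin: "finite I" and inj: "inj_on P I"
    and T: "\<And>a b. (a, b) \<in> T \<Longrightarrow> a \<in> I \<and> b \<in> I \<and> fst a < fst b \<and> R (P a) (P b)"
  shows "card T \<le> card {{x, y} | x y. x \<in> P ` I \<and> y \<in> P ` I \<and> x \<noteq> y \<and> R x y}"
    (is "_ \<le> card ?U")
proof (rule card_inj_on_le[where f = "\<lambda>(a, b). {P a, P b}"])
  show "inj_on (\<lambda>(a, b). {P a, P b}) T"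
  proof (rule inj_onI)
    fix p q assume pq: "p \<in> T" "q \<in> T" "(\<lambda>(a, b). {P a, P b}) p = (\<lambda>(a, b). {P a, P b}) q"
    obtain a b c d where p: "p = (a, b)" and q: "q = (c, d)" by (cases p; cases q)
    have t: "a \<in> I" "b \<in> I" "fst a < fst b" "c \<in> I" "d \<in> I" "fst c < fst d"
      using T pq unfolding p q by blast+
    from pq consider "P a = P c" "P b = P d" | "P a = P d" "P b = P c"
      by (auto simp: p q doubleton_eq_iff)
    then show "p = q"
    proof cases
      case 1
      then show ?thesis using t inj by (simp add: p q inj_on_eq_iff)
    next
      case 2
      then have "a = d" "b = c" using t inj by (simp_all add: inj_on_eq_iff)
      then show ?thesis using t by simp
    qed
  qed
  show "(\<lambda>(a, b). {P a, P b}) ` T \<subseteq> ?U"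
  proof clarify
    fix a1 a2 b1 b2 assume ab: "((a1, a2), (b1, b2)) \<in> T"
    note t = T[OF ab]
    then have "P (a1, a2) \<noteq> P (b1, b2)" using inj by (force dest: inj_onD)
    with t show "\<exists>x y. {P (a1, a2), P (b1, b2)} = {x, y} \<and> x \<in> P ` I \<and> y \<in> P ` I \<and> x \<noteq> y \<and> R x y"
      by blast
  qed
  show "finite ?U"
    by (rule finite_subset[of _ "Pow (P ` I)"]) (use fin in auto)
qed

lemma card_ints_near:
  fixes c t :: real
  assumes "t \<ge> 0"
  shows "finite {m::int. \<bar>of_int m - c\<bar> \<le> t}"
    and "real (card {m::int. \<bar>of_int m - c\<bar> \<le> t}) \<le> 2 * t + 1"
proof -
  have eq: "{m::int. \<bar>of_int m - c\<bar> \<le> t} = {\<lceil>c - t\<rceil>..\<lfloor>c + t\<rfloor>}"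
    by (auto simp: abs_le_iff le_floor_iff ceiling_le_iff)
  show "finite {m::int. \<bar>of_int m - c\<bar> \<le> t}" unfolding eq by simp
  show "real (card {m::int. \<bar>of_int m - c\<bar> \<le> t}) \<le> 2 * t + 1"
    unfolding eq using assms
    by (cases "\<lfloor>c + t\<rfloor> + 1 - \<lceil>c - t\<rceil> \<ge> 0") (simp_all, linarith+)
qed

text \<open>
  Starting the interval at \<open>0\<close> adds the one element that compensates the rounding.
\<close>
lemma card_atLeast_0_floor_ge: "x \<ge> 0 \<Longrightarrow> x \<le> real (card {0..\<lfloor>x::real\<rfloor>})"
  by simp

lemma finite_card_Sigma_le:
  fixes M :: real
  assumes "finite I" "\<And>a. a \<in> I \<Longrightarrow> finite (F a) \<and> real (card (F a)) \<le> M"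
  shows "finite (Sigma I F)" "real (card (Sigma I F)) \<le> real (card I) * M"
  using assms by (auto simp: sum_bounded_above)

text \<open>
  Apart from \<open>x > 16\<close>, the quantities are, up to constants and for \<open>x\<close> equal to \<open>r\<close> or
  \<open>s\<close>, the lengths of the index intervals that occur below; bounding them away from \<open>0\<close> allows
  a number of integers to be replaced by a length.
\<close>
lemma regime_bounds:
  fixes \<epsilon> \<delta> x :: real
  assumes "0 < 2 * \<epsilon>" "2 * \<epsilon> < \<delta>" "\<delta> \<le> 1 / 2" "x \<ge> 1 / \<epsilon>\<^sup>2"
  shows "x > 16" "4 < \<epsilon> * x" "1 < sqrt \<delta> * x" "1 < \<epsilon> * x / \<delta>"
proof -
  have e: "0 < \<epsilon>" "\<epsilon> < 1 / 4" using assms by auto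
  have "1 \<le> \<epsilon> * (\<epsilon> * x)" using assms(4) e by (simp add: field_simps power2_eq_square)
  then have ex0: "0 < \<epsilon> * x" using e zero_less_mult_pos[of \<epsilon> "\<epsilon> * x"] by linarith
  then have x: "x > 0" using e zero_less_mult_pos[of \<epsilon> x] by linarith
  have "\<epsilon> * (\<epsilon> * x) < (1/4) * (\<epsilon> * x)"
    using e ex0 by (intro mult_strict_right_mono) auto
  then show ex: "4 < \<epsilon> * x" using \<open>1 \<le> \<epsilon> * (\<epsilon> * x)\<close> by linarith
  have "\<epsilon> * x < (1/4) * x" using e x by (intro mult_strict_right_mono) auto
  then show "x > 16" using ex by linarith
  have "\<epsilon> \<le> \<delta>" using assms by linarith
  also have "\<delta> \<le> sqrt \<delta>" using assms by (intro real_le_rsqrt) (auto simp: power2_eq_square mult_le_cancel_left1)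
  finally have "\<epsilon> * x \<le> sqrt \<delta> * x" using x by (intro mult_right_mono) auto
  then show "1 < sqrt \<delta> * x" using ex by linarith
  show "1 < \<epsilon> * x / \<delta>" using ex assms by (simp add: field_simps)
qed


section \<open>Far and near pairs in terms of grid indices\<close>

text \<open>
  Translates closeness of the normalised angle to \<open>h\<close> into an interval for the second direction
  index; it is used for \<open>h\<close> in \<open>{0, 1, -1, 1/2, -1/2}\<close>.
\<close>
lemma angular_distance_le:
  fixes k k' r :: int and c h :: real
  assumes "r > 0"
  shows "\<bar>of_int (k - k') / (2 * of_int r) - h\<bar> \<le> c
    \<longleftrightarrow> \<bar>of_int k' - (of_int k - 2 * h * of_int r)\<bar> \<le> 2 * c * of_int r"
proof -
  have eq: "of_int (k - k') / (2 * of_int r) - h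
      = (of_int k - 2 * h * of_int r - of_int k') / (2 * of_int r)"
    using assms by (simp add: field_simps)
  show ?thesis unfolding eq using assms
    by (simp add: abs_divide pos_divide_le_eq abs_minus_commute mult_ac)
qed

text \<open>
  As \<open>a + b \<le> 1\<close> and \<open>4ab \<ge> 1/4\<close>, the distance formula leaves room only for
  \<open>cos\<^sup>2(\<pi> u) \<le> 4 (1 - (1 - \<delta>)\<^sup>2) \<le> 8 \<delta>\<close>; the constant \<open>9\<close> is taken in
  place of \<open>8\<close> for its rational square root.
\<close>
lemma far_imp_nearly_antipodal:
  assumes d: "0 < \<delta>" "\<delta> \<le> 1 / 2"
    and in1: "(k, l) \<in> grid r s" and in2: "(k', l') \<in> grid r s"
    and far: "norm (grid_point \<delta> r s (k, l) - grid_point \<delta> r s (k', l')) \<ge> 1 - \<delta>"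
  shows "\<bar>of_int k' - (of_int k - of_int r)\<bar> \<le> 3 * sqrt \<delta> * of_int r \<or>
         \<bar>of_int k' - (of_int k + of_int r)\<bar> \<le> 3 * sqrt \<delta> * of_int r"
proof -
  from in1 in2 have r: "r > 0" and kk: "\<bar>k - k'\<bar> < 2 * r" by (auto simp: grid_def)
  let ?a = "radius \<delta> s l" and ?b = "radius \<delta> s l'"
  let ?u = "of_int (k - k') / (2 * of_int r) :: real"
  have a: "1/4 \<le> ?a" "?a \<le> 1/2" and b: "1/4 \<le> ?b" "?b \<le> 1/2"
    using radius_bounds[OF d] in1 in2 by (auto simp: grid_def)
  have "(1 - \<delta>)\<^sup>2 \<le> (?a - ?b)\<^sup>2 + 4 * ?a * ?b * (sin (pi * ?u))\<^sup>2"
    unfolding norm_grid_point_diff_sq[OF r, symmetric] using far d by (intro power_mono) auto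
  also have "\<dots> = (?a + ?b)\<^sup>2 - 4 * ?a * ?b * (cos (pi * ?u))\<^sup>2"
    unfolding sin_squared_eq by (simp add: power2_eq_square algebra_simps)
  also have "\<dots> \<le> 1\<^sup>2 - 4 * (1/4) * (1/4) * (cos (pi * ?u))\<^sup>2"
  proof (intro diff_mono power_mono mult_right_mono zero_le_power2)
    show "4 * (1/4) * (1/4) \<le> 4 * ?a * ?b" using a b by (intro mult_mono) auto
  qed (use a b in auto)
  finally have "(1 - \<delta>)\<^sup>2 \<le> 1 - 1 / 4 * (cos (pi * ?u))\<^sup>2" by simp
  then have "(cos (pi * ?u))\<^sup>2 \<le> 4 * (1 - (1 - \<delta>)\<^sup>2)" by simp
  also have "\<dots> \<le> 9 * \<delta>" using d by (simp add: power2_eq_square algebra_simps)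
  also have "\<dots> = (3 * sqrt \<delta>)\<^sup>2" using d by (simp add: power_mult_distrib)
  finally have "(cos (pi * ?u))\<^sup>2 \<le> (3 * sqrt \<delta>)\<^sup>2" .
  moreover have "0 \<le> 3 * sqrt \<delta>" using d by simp
  ultimately have "\<bar>cos (pi * ?u)\<bar> \<le> 3 * sqrt \<delta>" by (simp only: power2_le_iff_abs_le)
  then have "\<bar>cos (pi * ?u)\<bar> \<le> 2 * (3 / 2 * sqrt \<delta>)" by simp
  moreover have "\<bar>of_int (k - k') :: real\<bar> < 2 * of_int r" using kk by linarith
  then have "\<bar>?u\<bar> \<le> 1" using r by (simp add: abs_divide)
  ultimately have "\<bar>?u - 1/2\<bar> \<le> 3 / 2 * sqrt \<delta> \<or> \<bar>?u - (-1/2)\<bar> \<le> 3 / 2 * sqrt \<delta>"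
    using abs_cos_pi_le_imp_near_half[of ?u "3 / 2 * sqrt \<delta>"] by simp
  then show ?thesis unfolding angular_distance_le[OF r] by simp
qed

text \<open>
  Of the loss of about \<open>2 \<delta>\<close> that is admissible for the squared distance, the radii use up at
  most \<open>\<delta>/2\<close>, because their sum is at least \<open>1 - \<delta>/4\<close>.  Half the angular deviation from
  the antipodal direction is \<open>\<pi> j / (2r) \<le> sqrt \<delta>\<close>, which uses up at most \<open>\<delta>\<close>.
\<close>
lemma nearly_antipodal_imp_far:
  assumes d: "0 < \<delta>" "\<delta> \<le> 1 / 2"
    and in1: "(k, l) \<in> grid r s" and in2: "(k', l') \<in> grid r s"
    and ll: "of_int l + of_int l' \<le> (of_int s / 2 :: real)"
    and k': "k' = k + r - j" and j: "0 \<le> j" "of_int j \<le> sqrt \<delta> * of_int r / 2"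
  shows "norm (grid_point \<delta> r s (k, l) - grid_point \<delta> r s (k', l')) \<ge> 1 - \<delta>"
proof -
  from in1 have r: "r > 0" and s: "s > 0" by (auto simp: grid_def)
  let ?a = "radius \<delta> s l" and ?b = "radius \<delta> s l'"
  let ?u = "of_int (k - k') / (2 * of_int r) :: real"
  have a: "1/4 \<le> ?a" "?a \<le> 1/2" and b: "1/4 \<le> ?b" "?b \<le> 1/2"
    using radius_bounds[OF d] in1 in2 by (auto simp: grid_def)
  have "pi * ?u = pi * of_int j / (2 * of_int r) - pi / 2"
    using r by (simp add: k' field_simps)
  then have "cos (pi * ?u) = sin (pi * of_int j / (2 * of_int r))"
    by (simp add: cos_diff)
  then have "\<bar>cos (pi * ?u)\<bar> \<le> \<bar>pi * of_int j / (2 * of_int r)\<bar>"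
    by (metis abs_sin_x_le_abs_x)
  also have "\<dots> = pi * of_int j / (2 * of_int r)" using j r by simp
  also have "\<dots> \<le> 4 * (sqrt \<delta> * of_int r / 2) / (2 * of_int r)"
    using j r pi_less_4 by (intro divide_right_mono mult_mono) auto
  also have "\<dots> = sqrt \<delta>" using r by simp
  finally have "(cos (pi * ?u))\<^sup>2 \<le> (sqrt \<delta>)\<^sup>2" using d by (simp only: power2_le_iff_abs_le real_sqrt_ge_zero less_imp_le)
  then have cos2: "(cos (pi * ?u))\<^sup>2 \<le> \<delta>" using d by simp
  have "\<delta> * (of_int l + of_int l') \<le> \<delta> * (of_int s / 2)"
    using ll d by (intro mult_left_mono) auto
  then have "\<delta> * (of_int l + of_int l') / (2 * of_int s) \<le> \<delta> / 4"
    using s by (simp add: pos_divide_le_eq)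
  moreover have "?a + ?b = 1 - \<delta> * (of_int l + of_int l') / (2 * of_int s)"
    by (simp add: radius_def add_divide_distrib distrib_left)
  ultimately have ab: "1 - \<delta> / 4 \<le> ?a + ?b" by linarith
  have "(1 - \<delta>)\<^sup>2 = (1 - \<delta> / 4)\<^sup>2 - \<delta> - (\<delta> / 2 - 15 / 16 * \<delta> * \<delta>)"
    by (simp add: power2_eq_square algebra_simps)
  also have "\<dots> \<le> (1 - \<delta> / 4)\<^sup>2 - \<delta>"
    using mult_right_mono[OF d(2), of \<delta>] d by linarith
  also have "\<dots> \<le> (?a + ?b)\<^sup>2 - 4 * (1/2) * (1/2) * (cos (pi * ?u))\<^sup>2"
    using ab cos2 d by (intro diff_mono power_mono) auto
  also have "\<dots> \<le> (?a + ?b)\<^sup>2 - 4 * ?a * ?b * (cos (pi * ?u))\<^sup>2"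
    using a b by (intro diff_mono mult_mono) auto
  also have "\<dots> = (?a - ?b)\<^sup>2 + 4 * ?a * ?b * (sin (pi * ?u))\<^sup>2"
    unfolding sin_squared_eq by (simp add: power2_eq_square algebra_simps)
  also have "\<dots> = (norm (grid_point \<delta> r s (k, l) - grid_point \<delta> r s (k', l')))\<^sup>2"
    by (rule norm_grid_point_diff_sq[OF r, symmetric])
  finally show ?thesis by (rule power2_le_imp_le) simp
qed

text \<open>
  Both summands in the distance formula are nonnegative, so each is at most \<open>\<epsilon>\<^sup>2\<close>.  The
  alternatives with \<open>2r\<close> account for the periodicity of the angle.
\<close>
lemma near_imp_index_close:
  assumes d: "0 < \<delta>" "\<delta> \<le> 1 / 2" and e: "0 \<le> \<epsilon>"
    and in1: "(k, l) \<in> grid r s" and in2: "(k', l') \<in> grid r s"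
    and near: "norm (grid_point \<delta> r s (k, l) - grid_point \<delta> r s (k', l')) \<le> \<epsilon>"
  shows "\<bar>of_int k' - of_int k\<bar> \<le> 2 * \<epsilon> * of_int r \<or>
         \<bar>of_int k' - (of_int k - 2 * of_int r)\<bar> \<le> 2 * \<epsilon> * of_int r \<or>
         \<bar>of_int k' - (of_int k + 2 * of_int r)\<bar> \<le> 2 * \<epsilon> * of_int r" (is ?angle)
    and "\<bar>of_int l' - of_int l\<bar> \<le> 2 * (\<epsilon> * of_int s / \<delta>)"
proof -
  from in1 in2 have r: "r > 0" and s: "s > 0" and kk: "\<bar>k - k'\<bar> < 2 * r" by (auto simp: grid_def)
  let ?a = "radius \<delta> s l" and ?b = "radius \<delta> s l'"
  let ?u = "of_int (k - k') / (2 * of_int r) :: real"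
  have ab: "1/4 \<le> ?a" "1/4 \<le> ?b" 
    using radius_bounds[OF d] in1 in2 by (auto simp: grid_def)
  have sq: "(?a - ?b)\<^sup>2 + 4 * ?a * ?b * (sin (pi * ?u))\<^sup>2 \<le> \<epsilon>\<^sup>2"
    unfolding norm_grid_point_diff_sq[OF r, symmetric] using near by (intro power_mono) auto
  have nn: "0 \<le> 4 * ?a * ?b * (sin (pi * ?u))\<^sup>2" using ab by auto
  have "(?a - ?b)\<^sup>2 \<le> \<epsilon>\<^sup>2" using sq nn by linarith
  then have "\<bar>?a - ?b\<bar> \<le> \<epsilon>" using e by (simp add: abs_le_square_iff[symmetric])
  then show "\<bar>of_int l' - of_int l\<bar> \<le> 2 * (\<epsilon> * of_int s / \<delta>)"
    unfolding abs_radius_diff[OF d(1) s] using s d by (simp add: field_simps)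
  have "4 * (1/4) * (1/4) * (sin (pi * ?u))\<^sup>2 \<le> 4 * ?a * ?b * (sin (pi * ?u))\<^sup>2"
    using ab by (intro mult_mono) auto
  also have "\<dots> \<le> \<epsilon>\<^sup>2" using sq zero_le_power2[of "?a - ?b"] by linarith
  finally have "(sin (pi * ?u))\<^sup>2 \<le> (2 * \<epsilon>)\<^sup>2" by (simp add: power_mult_distrib)
  moreover have "0 \<le> 2 * \<epsilon>" using e by simp
  ultimately have "\<bar>sin (pi * ?u)\<bar> \<le> 2 * \<epsilon>" by (simp only: power2_le_iff_abs_le)
  moreover have "\<bar>of_int (k - k') :: real\<bar> < 2 * of_int r" using kk by linarith
  then have "\<bar>?u\<bar> \<le> 1" using r by (simp add: abs_divide)
  ultimately have "\<bar>?u - 0\<bar> \<le> \<epsilon> \<or> \<bar>?u - 1\<bar> \<le> \<epsilon> \<or> \<bar>?u - (-1)\<bar> \<le> \<epsilon>"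
    using abs_sin_pi_le_imp_near_integer[of ?u \<epsilon>] by simp
  then show ?angle unfolding angular_distance_le[OF r] by simp
qed

text \<open>
  The radial and the angular summand of the squared distance are each at most \<open>(\<epsilon>/2)\<^sup>2\<close>.
\<close>
lemma index_close_imp_near:
  assumes d: "0 < \<delta>" "\<delta> \<le> 1 / 2" and e: "0 \<le> \<epsilon>"
    and in1: "(k, l) \<in> grid r s" and in2: "(k', l') \<in> grid r s"
    and kk: "\<bar>of_int (k' - k)\<bar> \<le> \<epsilon> * of_int r / 4"
    and ll: "\<bar>of_int (l' - l)\<bar> \<le> \<epsilon> * of_int s / \<delta>"
  shows "norm (grid_point \<delta> r s (k, l) - grid_point \<delta> r s (k', l')) \<le> \<epsilon>"
proof -
  from in1 in2 have r: "r > 0" and s: "s > 0" by (auto simp: grid_def)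
  let ?a = "radius \<delta> s l" and ?b = "radius \<delta> s l'"
  let ?u = "of_int (k - k') / (2 * of_int r) :: real"
  have a: "1/4 \<le> ?a" "?a \<le> 1/2" and b: "1/4 \<le> ?b" "?b \<le> 1/2"
    using radius_bounds[OF d] in1 in2 by (auto simp: grid_def)
  have "\<bar>of_int l' - of_int l\<bar> * \<delta> \<le> \<epsilon> * of_int s" using ll d by (simp add: pos_le_divide_eq)
  then have "\<bar>?a - ?b\<bar> \<le> \<epsilon> / 2"
    unfolding abs_radius_diff[OF d(1) s] using s by (simp add: field_simps)
  then have rad: "(?a - ?b)\<^sup>2 \<le> (\<epsilon> / 2)\<^sup>2" using e by (simp add: abs_le_square_iff[symmetric])
  have "\<bar>sin (pi * ?u)\<bar> \<le> \<bar>pi * ?u\<bar>" by (rule abs_sin_x_le_abs_x)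
  also have "\<dots> = pi * \<bar>of_int (k' - k)\<bar> / (2 * of_int r)"
    using r by (simp add: abs_mult abs_divide abs_minus_commute)
  also have "\<dots> \<le> 4 * (\<epsilon> * of_int r / 4) / (2 * of_int r)"
    using kk r e pi_less_4 by (intro divide_right_mono mult_mono) auto
  also have "\<dots> = \<epsilon> / 2" using r by simp
  finally have ang: "(sin (pi * ?u))\<^sup>2 \<le> (\<epsilon> / 2)\<^sup>2" using e by (simp add: abs_le_square_iff[symmetric])
  have "(norm (grid_point \<delta> r s (k, l) - grid_point \<delta> r s (k', l')))\<^sup>2
      = (?a - ?b)\<^sup>2 + 4 * ?a * ?b * (sin (pi * ?u))\<^sup>2"
    by (rule norm_grid_point_diff_sq[OF r])
  also have "\<dots> \<le> (\<epsilon> / 2)\<^sup>2 + 4 * (1/2) * (1/2) * (\<epsilon> / 2)\<^sup>2"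
    using a b by (intro add_mono mult_mono rad ang) auto
  also have "\<dots> \<le> \<epsilon>\<^sup>2" by (simp add: power2_eq_square)
  finally show ?thesis using e by (rule power2_le_imp_le)
qed

section \<open>Upper bounds\<close>

text \<open>
  There are \<open>2rs\<close> choices for the first point; the second has \<open>s\<close> possible radii and its
  direction index lies in one of two intervals, with at most \<open>7 sqrt \<delta> r\<close> integers each.
\<close>
lemma card_far_pairs_le:
  assumes d: "0 < \<delta>" "\<delta> \<le> 1 / 2" and r: "r > 0" and s: "s > 0"
    and dr: "1 \<le> sqrt \<delta> * of_int r"
  shows "real (card (far_pairs \<delta> (AU \<delta> r s))) \<le> 28 * (sqrt \<delta> * (of_int r)\<^sup>2 * (of_int s)\<^sup>2)"
proof -
  define t where "t = 3 * sqrt \<delta> * of_int r"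
  have t: "0 \<le> t" using d r by (simp add: t_def)
  define K :: "int \<Rightarrow> int set" where
    "K k = {m. \<bar>of_int m - (of_int k - of_int r)\<bar> \<le> t} \<union> {m. \<bar>of_int m - (of_int k + of_int r)\<bar> \<le> t}" for k
  have K: "finite (K k)" "real (card (K k)) \<le> 14 * (sqrt \<delta> * of_int r)" for k
  proof -
    show "finite (K k)" unfolding K_def using card_ints_near(1)[OF t] by blast
    have "real (card (K k)) \<le> (2 * t + 1) + (2 * t + 1)"
      unfolding K_def
      using card_Un_le[of "{m. \<bar>of_int m - (of_int k - of_int r)\<bar> \<le> t}" "{m. \<bar>of_int m - (of_int k + of_int r)\<bar> \<le> t}"]
        card_ints_near(2)[OF t, of "of_int k - of_int r"] card_ints_near(2)[OF t, of "of_int k + of_int r"]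
      by linarith
    then show "real (card (K k)) \<le> 14 * (sqrt \<delta> * of_int r)"
      using dr unfolding t_def mult.assoc by linarith
  qed
  let ?F = "\<lambda>a::int \<times> int. K (fst a) \<times> {0..s - 1}"
  have F: "finite (?F a) \<and> real (card (?F a)) \<le> 14 * (sqrt \<delta> * of_int r) * of_int s" for a
    using K s by (auto simp: card_cartesian_product intro!: mult_right_mono)
  note T = finite_card_Sigma_le[of "grid r s" ?F, OF _ F]
  have fin: "finite (grid r s)" by (simp add: grid_def)
  have "card (far_pairs \<delta> (AU \<delta> r s)) \<le> card (Sigma (grid r s) ?F)"
    unfolding far_pairs_def AU_eq_image_grid
  proof (rule card_unordered_pairs_le[OF T(1)[OF fin]])
    fix a b assume "a \<in> grid r s" "b \<in> grid r s"
      "norm (grid_point \<delta> r s a - grid_point \<delta> r s b) \<ge> 1 - \<delta>"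
    then show "(a, b) \<in> Sigma (grid r s) ?F"
      using far_imp_nearly_antipodal[OF d, of "fst a" "snd a" r s "fst b" "snd b"]
      by (auto simp: K_def t_def grid_def)
  qed
  then have "real (card (far_pairs \<delta> (AU \<delta> r s)))
      \<le> real (card (grid r s)) * (14 * (sqrt \<delta> * of_int r) * of_int s)"
    using T(2)[OF fin] by linarith
  also have "\<dots> = 28 * (sqrt \<delta> * (of_int r)\<^sup>2 * (of_int s)\<^sup>2)"
    using r s by (simp add: card_grid power2_eq_square)
  finally show ?thesis .
qed

text \<open>
  There are \<open>2rs\<close> choices for the first point; for the second, the direction index lies in one of
  three intervals with at most \<open>5 \<epsilon> r\<close> integers each, and the radius index in an interval
  with at most \<open>5 \<epsilon> s/\<delta>\<close> integers.
\<close>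
lemma card_near_pairs_le:
  assumes d: "0 < \<delta>" "\<delta> \<le> 1 / 2" and e: "0 < \<epsilon>" and r: "r > 0" and s: "s > 0"
    and er: "1 \<le> \<epsilon> * of_int r" and es: "1 \<le> \<epsilon> * of_int s / \<delta>"
  shows "real (card (near_pairs \<epsilon> (AU \<delta> r s))) \<le> 150 * ((\<epsilon> * of_int r * of_int s)\<^sup>2 / \<delta>)"
proof -
  define t where "t = 2 * \<epsilon> * of_int r"
  define w where "w = 2 * (\<epsilon> * of_int s / \<delta>)"
  have t: "0 \<le> t" using e r by (simp add: t_def)
  have w: "0 \<le> w" using es by (simp add: w_def)
  let ?N = "\<lambda>c u. {m::int. \<bar>of_int m - c\<bar> \<le> (u::real)}"
  define K :: "int \<Rightarrow> int set" where
    "K k = ?N (of_int k) t \<union> (?N (of_int k - 2 * of_int r) t \<union> ?N (of_int k + 2 * of_int r) t)" for k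
  have K: "finite (K k)" "real (card (K k)) \<le> 15 * (\<epsilon> * of_int r)" for k
  proof -
    show "finite (K k)" unfolding K_def using card_ints_near(1)[OF t] by blast
    have "real (card (K k)) \<le> (2 * t + 1) + ((2 * t + 1) + (2 * t + 1))"
      unfolding K_def
      using card_Un_le[of "?N (of_int k) t" "?N (of_int k - 2 * of_int r) t \<union> ?N (of_int k + 2 * of_int r) t"]
        card_Un_le[of "?N (of_int k - 2 * of_int r) t" "?N (of_int k + 2 * of_int r) t"]
        card_ints_near(2)[OF t, of "of_int k"] card_ints_near(2)[OF t, of "of_int k - 2 * of_int r"]
        card_ints_near(2)[OF t, of "of_int k + 2 * of_int r"]
      by linarith
    then show "real (card (K k)) \<le> 15 * (\<epsilon> * of_int r)" using er unfolding t_def mult.assoc by linarith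
  qed
  have L: "real (card (?N (of_int l) w)) \<le> 5 * (\<epsilon> * of_int s / \<delta>)" for l :: int
    using card_ints_near(2)[OF w, of "of_int l"] es unfolding w_def by linarith
  let ?F = "\<lambda>a::int \<times> int. K (fst a) \<times> ?N (of_int (snd a)) w"
  have F: "finite (?F a) \<and> real (card (?F a)) \<le> (15 * (\<epsilon> * of_int r)) * (5 * (\<epsilon> * of_int s / \<delta>))" for a
    unfolding card_cartesian_product of_nat_mult
    using K L e r card_ints_near(1)[OF w] by (intro conjI finite_cartesian_product mult_mono) auto
  note T = finite_card_Sigma_le[of "grid r s" ?F, OF _ F]
  have fin: "finite (grid r s)" by (simp add: grid_def)
  have "card (near_pairs \<epsilon> (AU \<delta> r s)) \<le> card (Sigma (grid r s) ?F)"
    unfolding near_pairs_def AU_eq_image_grid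
  proof (rule card_unordered_pairs_le[OF T(1)[OF fin]])
    fix a b assume "a \<in> grid r s" "b \<in> grid r s"
      "norm (grid_point \<delta> r s a - grid_point \<delta> r s b) \<le> \<epsilon>"
    then show "(a, b) \<in> Sigma (grid r s) ?F"
      using near_imp_index_close[OF d less_imp_le[OF e], of "fst a" "snd a" r s "fst b" "snd b"]
      by (cases a; cases b) (auto simp: K_def t_def w_def)
  qed
  then have "real (card (near_pairs \<epsilon> (AU \<delta> r s)))
      \<le> real (card (grid r s)) * ((15 * (\<epsilon> * of_int r)) * (5 * (\<epsilon> * of_int s / \<delta>)))"
    using T(2)[OF fin] by linarith
  also have "\<dots> = 150 * ((\<epsilon> * of_int r * of_int s)\<^sup>2 / \<delta>)"
    using r s by (simp add: card_grid power2_eq_square)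
  finally show ?thesis .
qed

section \<open>Lower bounds\<close>

text \<open>
  The family consists of a point in the lower half plane together with a point in a nearly opposite
  direction, at index \<open>k + r - j\<close>; both radius indices stay below \<open>s/4\<close>, so that the points
  are close to the outer circle.  Allowing \<open>j\<close> of only one sign keeps the index of the second
  point within the grid.
\<close>
lemma card_far_pairs_ge:
  assumes d: "0 < \<delta>" "\<delta> \<le> 1 / 2" and r: "r > 0" and s: "s > 1"
  shows "1 / 32 * (sqrt \<delta> * (of_int r)\<^sup>2 * (of_int s)\<^sup>2) \<le> real (card (far_pairs \<delta> (AU \<delta> r s)))"
proof -
  let ?L = "{0..\<lfloor>of_int s / 4 :: real\<rfloor>}" and ?J = "{0..\<lfloor>sqrt \<delta> * of_int r / 2\<rfloor>}"
  let ?D = "({-r..-1} \<times> ?J) \<times> (?L \<times> ?L)"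
  let ?g = "\<lambda>((k, j), (l, l')). ((k, l), (k + r - j, l')) :: (int \<times> int) \<times> (int \<times> int)"
  have fin: "finite (grid r s)" by (simp add: grid_def)
  have "1 / 32 * (sqrt \<delta> * (of_int r)\<^sup>2 * (of_int s)\<^sup>2)
      = (of_int r * (sqrt \<delta> * of_int r / 2)) * ((of_int s / 4) * (of_int s / 4))"
    by (simp add: power2_eq_square)
  also have "\<dots> \<le> (of_int r * real (card ?J)) * (real (card ?L) * real (card ?L))"
    using d r s by (intro mult_mono card_atLeast_0_floor_ge) auto
  also have "\<dots> = real (card ?D)" using r by (simp add: card_cartesian_product)
  also have "card ?D = card (?g ` ?D)"
    by (rule card_image[symmetric], rule inj_on_subset[OF _ subset_UNIV]) (auto simp: inj_def)
  also have "card (?g ` ?D) \<le> card (far_pairs \<delta> (AU \<delta> r s))"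
    unfolding far_pairs_def AU_eq_image_grid
  proof (rule card_le_unordered_pairs[OF fin inj_on_grid_point[OF d]])
    fix a b assume "(a, b) \<in> ?g ` ?D"
    then obtain k j l l' where a: "a = (k, l)" and b: "b = (k + r - j, l')"
      and k: "-r \<le> k" "k \<le> -1" and j: "0 \<le> j" "of_int j \<le> sqrt \<delta> * of_int r / 2"
      and l: "0 \<le> l" "of_int l \<le> (of_int s / 4 :: real)"
      and l': "0 \<le> l'" "of_int l' \<le> (of_int s / 4 :: real)"
      by (auto simp: le_floor_iff)
    have "sqrt \<delta> * of_int r \<le> 1 * of_int r" using d r by (intro mult_right_mono) auto
    then have jr: "j < r" using j r by linarith
    have ls: "l \<le> s - 1" "l' \<le> s - 1" using l l' s by linarith+
    have ag: "a \<in> grid r s" and bg: "b \<in> grid r s"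
      using k j l l' ls jr by (auto simp: a b grid_def)
    have "1 - \<delta> \<le> norm (grid_point \<delta> r s a - grid_point \<delta> r s b)"
      using ag bg unfolding a b
      by (rule nearly_antipodal_imp_far[OF d _ _ _ refl j]) (use l l' in linarith)
    with ag bg jr show "a \<in> grid r s \<and> b \<in> grid r s \<and> fst a < fst b \<and>
        1 - \<delta> \<le> norm (grid_point \<delta> r s a - grid_point \<delta> r s b)"
      by (simp add: a b)
  qed
  finally show ?thesis by simp
qed

text \<open>
  The family consists of a point in the lower half plane and in the outer half of the annulus, shifted
  by \<open>j\<close> directions and \<open>i\<close> radii.  Since \<open>2 \<epsilon> < \<delta>\<close>, the shift
  \<open>i \<le> \<epsilon> s/\<delta>\<close> is less than \<open>s/2\<close> and does not leave the annulus.
\<close>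
lemma card_near_pairs_ge:
  assumes d: "0 < \<delta>" "\<delta> \<le> 1 / 2" and e: "0 < \<epsilon>" "2 * \<epsilon> < \<delta>" and s: "s > 0"
    and er: "4 \<le> \<epsilon> * of_int r"
  shows "1 / 16 * ((\<epsilon> * of_int r * of_int s)\<^sup>2 / \<delta>) \<le> real (card (near_pairs \<epsilon> (AU \<delta> r s)))"
proof -
  have r: "r > 0" using er zero_less_mult_pos[OF _ e(1), of "of_int r"] by simp
  let ?L = "{0..\<lfloor>of_int s / 2 :: real\<rfloor>}" and ?I = "{0..\<lfloor>\<epsilon> * of_int s / \<delta>\<rfloor>}"
  let ?J = "{1..\<lfloor>\<epsilon> * of_int r / 4\<rfloor>}"
  let ?D = "({-r..-1} \<times> ?J) \<times> (?L \<times> ?I)"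
  let ?g = "\<lambda>((k, j), (l, i)). ((k, l), (k + j, l + i)) :: (int \<times> int) \<times> (int \<times> int)"
  have fin: "finite (grid r s)" by (simp add: grid_def)
  \<comment> \<open>Starting at \<open>j = 1\<close> makes the points distinct; rounding down then costs at most a factor \<open>2\<close>.\<close>
  have "1 \<le> \<lfloor>\<epsilon> * of_int r / 4\<rfloor>" using er by (simp add: le_floor_iff)
  moreover from this have "real (card ?J) = of_int \<lfloor>\<epsilon> * of_int r / 4\<rfloor>" by simp
  ultimately have J: "\<epsilon> * of_int r / 8 \<le> real (card ?J)" using er by linarith
  have "1 / 16 * ((\<epsilon> * of_int r * of_int s)\<^sup>2 / \<delta>)
      = (of_int r * (\<epsilon> * of_int r / 8)) * ((of_int s / 2) * (\<epsilon> * of_int s / \<delta>))"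
    by (simp add: power2_eq_square)
  also have "\<dots> \<le> (of_int r * real (card ?J)) * (real (card ?L) * real (card ?I))"
    using d e r s by (intro mult_mono J card_atLeast_0_floor_ge) auto
  also have "\<dots> = real (card ?D)" using r by (simp add: card_cartesian_product)
  also have "card ?D = card (?g ` ?D)"
    by (rule card_image[symmetric], rule inj_on_subset[OF _ subset_UNIV]) (auto simp: inj_def)
  also have "card (?g ` ?D) \<le> card (near_pairs \<epsilon> (AU \<delta> r s))"
    unfolding near_pairs_def AU_eq_image_grid
  proof (rule card_le_unordered_pairs[OF fin inj_on_grid_point[OF d]])
    fix a b assume "(a, b) \<in> ?g ` ?D"
    then obtain k j l i where a: "a = (k, l)" and b: "b = (k + j, l + i)"
      and k: "-r \<le> k" "k \<le> -1" and j: "1 \<le> j" "of_int j \<le> \<epsilon> * of_int r / 4"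
      and l: "0 \<le> l" "of_int l \<le> (of_int s / 2 :: real)"
      and i: "0 \<le> i" "of_int i \<le> \<epsilon> * of_int s / \<delta>"
      by (auto simp: le_floor_iff)
    have "\<epsilon> * of_int r \<le> 1 * of_int r" using d e r by (intro mult_right_mono) auto
    then have jr: "j < r" using j r by linarith
    have "2 * \<epsilon> * of_int s < \<delta> * of_int s" using e s by (intro mult_strict_right_mono) auto
    then have "\<epsilon> * of_int s / \<delta> < of_int s / 2" using d by (simp add: field_simps)
    then have lis: "l + i < s" using l i by linarith
    have ag: "a \<in> grid r s" and bg: "b \<in> grid r s"
      using k j l i lis jr by (auto simp: a b grid_def)
    have "norm (grid_point \<delta> r s a - grid_point \<delta> r s b) \<le> \<epsilon>"
      using ag bg unfolding a b
      by (rule index_close_imp_near[OF d less_imp_le[OF e(1)]]) (use i j in auto)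
    with ag bg j show "a \<in> grid r s \<and> b \<in> grid r s \<and> fst a < fst b \<and>
        norm (grid_point \<delta> r s a - grid_point \<delta> r s b) \<le> \<epsilon>"
      by (simp add: a b)
  qed
  finally show ?thesis by simp
qed

section \<open>The orders of magnitude\<close>

theorem proposition5p1:
  shows
    "(\<exists>c C :: real. 0 < c \<and> c \<le> C \<and>
       (\<forall>(\<epsilon>::real) (\<delta>::real) (r::int) (s::int).
          0 < 2 * \<epsilon> \<and> 2 * \<epsilon> < \<delta> \<and> \<delta> \<le> 1 / 2 \<and>
          of_int r \<ge> 1 / \<epsilon>\<^sup>2 \<and> of_int s \<ge> 1 / \<epsilon>\<^sup>2 \<longrightarrow>
          c * (sqrt \<delta> * (of_int r)\<^sup>2 * (of_int s)\<^sup>2) \<le> real (card (far_pairs \<delta> (AU \<delta> r s))) \<and>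
          real (card (far_pairs \<delta> (AU \<delta> r s))) \<le> C * (sqrt \<delta> * (of_int r)\<^sup>2 * (of_int s)\<^sup>2)))
     \<and>
     (\<exists>c C :: real. 0 < c \<and> c \<le> C \<and>
       (\<forall>(\<epsilon>::real) (\<delta>::real) (r::int) (s::int).
          0 < 2 * \<epsilon> \<and> 2 * \<epsilon> < \<delta> \<and> \<delta> \<le> 1 / 2 \<and>
          of_int r \<ge> 1 / \<epsilon>\<^sup>2 \<and> of_int s \<ge> 1 / \<epsilon>\<^sup>2 \<longrightarrow>
          c * ((\<epsilon> * of_int r * of_int s)\<^sup>2 / \<delta>) \<le> real (card (near_pairs \<epsilon> (AU \<delta> r s))) \<and>
          real (card (near_pairs \<epsilon> (AU \<delta> r s))) \<le> C * ((\<epsilon> * of_int r * of_int s)\<^sup>2 / \<delta>)))"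
  (is "(\<exists>c C. _ \<and> _ \<and> (\<forall>\<epsilon> \<delta> r s. ?regime \<epsilon> \<delta> r s \<longrightarrow> _ c \<epsilon> \<delta> r s \<and> _)) \<and> _")
proof (rule conjI; (rule exI)+; intro conjI allI impI)
  show "(0::real) < 1 / 32" "(1::real) / 32 \<le> 28" "(0::real) < 1 / 16" "(1::real) / 16 \<le> 150"
    by simp_all
next
  fix \<epsilon> \<delta> :: real and r s :: int
  assume h: "?regime \<epsilon> \<delta> r s"
  then have d: "0 < \<delta>" "\<delta> \<le> 1 / 2" and e: "0 < \<epsilon>" "2 * \<epsilon> < \<delta>" by auto
  note rb = regime_bounds[of \<epsilon> \<delta> "of_int r"] and sb = regime_bounds[of \<epsilon> \<delta> "of_int s"]
  show "1 / 32 * (sqrt \<delta> * (of_int r)\<^sup>2 * (of_int s)\<^sup>2) \<le> real (card (far_pairs \<delta> (AU \<delta> r s)))"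
    using card_far_pairs_ge[OF d] rb sb h by simp
  show "real (card (far_pairs \<delta> (AU \<delta> r s))) \<le> 28 * (sqrt \<delta> * (of_int r)\<^sup>2 * (of_int s)\<^sup>2)"
    using card_far_pairs_le[OF d] rb sb h by simp
  show "1 / 16 * ((\<epsilon> * of_int r * of_int s)\<^sup>2 / \<delta>) \<le> real (card (near_pairs \<epsilon> (AU \<delta> r s)))"
    using card_near_pairs_ge[OF d e] rb sb h by simp
  show "real (card (near_pairs \<epsilon> (AU \<delta> r s))) \<le> 150 * ((\<epsilon> * of_int r * of_int s)\<^sup>2 / \<delta>)"
    using card_near_pairs_le[OF d e(1)] rb sb h by simp
qed

end
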